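(* For all $n\geq 0$, $\mathrm{psf}(8n+2)\equiv \mathrm{psf}(8n+5)\pmod 2$.
   Context: For $n\ge1$, $\mathrm{psf}(n)$ denotes the total number of parts (counted with multiplicity) in all the partitions in $\mathcal{SF}(n)$, the set of semi-Fibonacci partitions of $n$, defined as follows. A partition of $n$ is a weakly decreasing sequence (equivalently, a finite multiset) of positive integers with sum $n$. The sets $\mathcal{SF}(n)$ are defined recursively by $\mathcal{SF}(1)=\{(1)\}$, $\mathcal{SF}(2)=\{(2)\}$, and, for $n\ge1$: the partitions in $\mathcal{SF}(2n)$ are the partitions of $\mathcal{SF}(n)$ with each part doubled; the partitions in $\mathcal{SF}(2n+1)$ are the partitions of $\mathcal{SF}(2n)$ each with an additional part equal to $1$, together with the partitions in $\mathcal{SF}(2n-1)$ each with its unique odd part increased by $2$. (Each partition in $\mathcal{SF}(m)$ with $m$ odd has exactly one odd part.) *)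

theory Defs
  imports Main "HOL-Library.Multiset" "HOL-Number_Theory.Cong"
begin

text \<open>Partitions are finite multisets of positive integers.\<close>

text \<open>On a partition with exactly one odd part, as is every member of \<open>SF m\<close> for odd \<open>m\<close>
  (lemma \<open>SF_unique_odd_part\<close>), this increases that part by 2.\<close>

definition bump_odd_part :: "nat multiset \<Rightarrow> nat multiset" where
  "bump_odd_part p = image_mset (\<lambda>k. if odd k then k + 2 else k) p"

text \<open>The recursion is only meant for positive arguments; \<open>SF 0 = {}\<close> is a dummy value that
  no other value depends on. The equations as usually written are \<open>SF_1\<close>, \<open>SF_2\<close>,
  \<open>SF_double\<close> and \<open>SF_odd\<close>.\<close>

fun SF :: "nat \<Rightarrow> nat multiset set" where
  "SF m =
    (if m = 0 then {}
     else if m = 1 then {{#1#}}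
     else if m = 2 then {{#2#}}
     else if even m then image_mset (\<lambda>k. 2 * k) ` SF (m div 2)
     else add_mset 1 ` SF (m - 1) \<union> bump_odd_part ` SF (m - 2))"

declare SF.simps [simp del]

definition psf :: "nat \<Rightarrow> nat" where
  "psf m = (\<Sum>p\<in>SF m. size p)"

lemma SF_1: "SF 1 = {{#1#}}"
  by (simp add: SF.simps)

lemma SF_2: "SF 2 = {{#2#}}"
  by (simp add: SF.simps)

lemma SF_double: "n \<ge> 1 \<Longrightarrow> SF (2 * n) = image_mset (\<lambda>k. 2 * k) ` SF n"
  by (cases "n = 1") (simp_all add: SF.simps [of "2 * n"] SF_1 [simplified] SF_2)

lemma SF_odd:
  "n \<ge> 1 \<Longrightarrow> SF (2 * n + 1) = add_mset 1 ` SF (2 * n) \<union> bump_odd_part ` SF (2 * n - 1)"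
  by (subst SF.simps) auto

lemma SF_induct [consumes 1, case_names one double odd]:
  fixes m :: nat
  assumes "m \<ge> 1" and one: "P 1"
    and double: "\<And>n. n \<ge> 1 \<Longrightarrow> P n \<Longrightarrow> P (2 * n)"
    and odd: "\<And>n. n \<ge> 1 \<Longrightarrow> P (2 * n) \<Longrightarrow> P (2 * n - 1) \<Longrightarrow> P (2 * n + 1)"
  shows "P m"
  using \<open>m \<ge> 1\<close>
proof (induction m rule: less_induct)
  case (less m)
  show ?case
  proof (cases "even m")
    case True
    then obtain n where m: "m = 2 * n" by blast
    show ?thesis unfolding m by (rule double) (use less m in auto)
  next
    case False
    then obtain n where m: "m = 2 * n + 1" by (rule oddE)
    show ?thesis
    proof (cases "n = 0")
      case True
      then show ?thesis using one m by simp
    next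
      case False
      show ?thesis unfolding m by (rule odd) (use less m False in auto)
    qed
  qed
qed

lemma finite_SF: "finite (SF m)"
proof (cases "m = 0")
  case True
  then show ?thesis by (simp add: SF.simps)
next
  case False
  then have "m \<ge> 1" by simp
  then show ?thesis
    by (induction m rule: SF_induct) (simp_all only: SF_1 SF_double SF_odd, auto)
qed

lemma SF_even_parts: "n \<ge> 1 \<Longrightarrow> p \<in> SF (2 * n) \<Longrightarrow> filter_mset odd p = {#}"
  by (auto simp: SF_double)

lemma filter_odd_bump: "filter_mset odd (bump_odd_part p) = image_mset (\<lambda>k. k + 2) (filter_mset odd p)"
  unfolding bump_odd_part_def by (induction p) auto

lemma SF_unique_odd_part:
  assumes "odd m" "p \<in> SF m"
  shows "size (filter_mset odd p) = 1"
proof -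
  have "m \<ge> 1" using assms(1) by (cases m) auto
  then show ?thesis using assms
  proof (induction m arbitrary: p rule: SF_induct)
    case one
    then show ?case by (simp add: SF_1 [simplified])
  next
    case (double n)
    then show ?case by simp
  next
    case (odd n)
    from odd.prems odd.hyps consider q where "q \<in> SF (2 * n)" "p = add_mset 1 q"
      | q where "q \<in> SF (2 * n - 1)" "p = bump_odd_part q"
      by (auto simp only: SF_odd)
    then show ?case
    proof cases
      case 1
      then show ?thesis using SF_even_parts odd.hyps by simp
    next
      case 2
      then show ?thesis using odd.IH(2) [of q] odd.hyps by (simp add: filter_odd_bump)
    qed
  qed
qed

lemma sum_bump: "sum_mset (bump_odd_part p) = sum_mset p + 2 * size (filter_mset odd p)"
  unfolding bump_odd_part_def by (induction p) auto

lemma SF_partition: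
  assumes "p \<in> SF m"
  shows "sum_mset p = m \<and> 0 \<notin># p"
proof -
  have "m \<ge> 1" using assms by (cases m) (auto simp: SF.simps [of 0])
  then show ?thesis using assms
  proof (induction m arbitrary: p rule: SF_induct)
    case one
    then show ?case by (simp add: SF_1 [simplified])
  next
    case (double n)
    then show ?case by (auto simp: SF_double simp flip: sum_mset_distrib_left)
  next
    case (odd n)
    from odd.prems odd.hyps consider q where "q \<in> SF (2 * n)" "p = add_mset 1 q"
      | q where "q \<in> SF (2 * n - 1)" "p = bump_odd_part q"
      by (auto simp only: SF_odd)
    then show ?case
    proof cases
      case 1
      then show ?thesis using odd.IH(1) by simp
    next
      case 2
      have "odd (2 * n - 1)" using odd.hyps by simp
      then have "size (filter_mset odd q) = 1" using 2 SF_unique_odd_part by blast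
      moreover have "0 \<notin># p" using 2 odd.IH(2) by (auto simp: bump_odd_part_def)
      ultimately show ?thesis using 2 odd.IH(2) odd.hyps by (simp add: sum_bump)
    qed
  qed
qed

end

theory Submission
  imports Defs
begin

text \<open>
  Write \<open>s m = card (SF m)\<close>. The two families that make up \<open>SF (2 * n + 1)\<close> are disjoint, since only
  the first one has 1 as a part, and both maps producing them are injective. Hence
  \<open>psf (2 * n) = psf n\<close> and \<open>psf (2 * n + 1) = psf (2 * n) + s (2 * n) + psf (2 * n - 1)\<close>, and \<open>s\<close>
  satisfies \<open>s (2 * n) = s n\<close> and \<open>s (2 * n + 1) = s (2 * n) + s (2 * n - 1)\<close>.

  The recursion for \<open>s (2 * n + 1)\<close> combines neighbouring values as Fibonacci's does, and modulo 2 the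
  Fibonacci numbers vanish exactly at the multiples of 3. Doubling an index preserves divisibility
  by 3, so here too \<open>s m\<close> is even exactly when 3 divides \<open>m\<close> (lemma \<open>even_card_SF_iff\<close>). Thus the parity of \<open>psf\<close> obeys a
  recursion whose inhomogeneous term depends only on residues modulo 3.

  Unfolding \<open>psf (8 * n + 5)\<close> twice down to \<open>psf (8 * n + 1)\<close> turns the theorem into a comparison of
  \<open>psf (8 * n + 1)\<close> with \<open>psf (2 * n + 1)\<close>: their sum is even exactly when 3 divides \<open>n\<close> (lemma
  \<open>even_psf_add_iff\<close>). This follows by induction, because modulo 2 both terms grow by
  \<open>psf (n + 1)\<close> from \<open>n\<close> to \<open>n + 1\<close>, up to cardinalities of known parity.
\<close>

lemma inj_bump_odd_part: "inj bump_odd_part"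
proof -
  have "inj (\<lambda>k::nat. if odd k then k + 2 else k)"
    by (rule injI) (auto split: if_splits)
  then show ?thesis
    unfolding bump_odd_part_def by (rule multiset.inj_map)
qed

lemma inj_double_parts: "inj (image_mset (\<lambda>k::nat. 2 * k))"
  by (rule multiset.inj_map) (simp add: inj_def)

lemma one_notin_bump_odd_part: "0 \<notin># p \<Longrightarrow> 1 \<notin># bump_odd_part p"
  by (auto simp: bump_odd_part_def split: if_splits)

lemma SF_odd_disjoint: "add_mset 1 ` A \<inter> bump_odd_part ` SF m = {}"
proof -
  have "1 \<in># q" if "q \<in> add_mset 1 ` A" for q
    using that by auto
  moreover have "1 \<notin># q" if "q \<in> bump_odd_part ` SF m" for q
    using that SF_partition one_notin_bump_odd_part by blast
  ultimately show ?thesis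
    by blast
qed

text \<open>With \<open>f\<close> constantly 1 this gives the recursion for the number of partitions, and with
  \<open>f = size\<close> the one for the number of parts.\<close>

lemma sum_SF_odd:
  fixes f :: "nat multiset \<Rightarrow> nat"
  assumes "n \<ge> 1"
  shows "(\<Sum>p\<in>SF (2 * n + 1). f p)
    = (\<Sum>p\<in>SF (2 * n). f (add_mset 1 p)) + (\<Sum>p\<in>SF (2 * n - 1). f (bump_odd_part p))"
proof -
  have "inj_on (add_mset 1) (SF (2 * n))"
    by (simp add: inj_on_def)
  moreover have "inj_on bump_odd_part (SF (2 * n - 1))"
    using inj_bump_odd_part by (rule inj_on_subset) simp
  ultimately show ?thesis
    by (simp add: SF_odd [OF assms, simplified] sum.union_disjoint SF_odd_disjoint [simplified]
        finite_SF sum.reindex)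
qed

lemma sum_SF_double:
  fixes f :: "nat multiset \<Rightarrow> nat"
  assumes "n \<ge> 1"
  shows "(\<Sum>p\<in>SF (2 * n). f p) = (\<Sum>p\<in>SF n. f (image_mset (\<lambda>k. 2 * k) p))"
  using inj_on_subset [OF inj_double_parts subset_UNIV]
  by (simp add: SF_double [OF assms] sum.reindex)

lemma card_SF_double: "n \<ge> 1 \<Longrightarrow> card (SF (2 * n)) = card (SF n)"
  using sum_SF_double [of n "\<lambda>_. 1"] by simp

lemma card_SF_odd: "n \<ge> 1 \<Longrightarrow> card (SF (2 * n + 1)) = card (SF (2 * n)) + card (SF (2 * n - 1))"
  using sum_SF_odd [of n "\<lambda>_. 1"] by simp

lemma psf_double: "n \<ge> 1 \<Longrightarrow> psf (2 * n) = psf n"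
  by (simp add: psf_def sum_SF_double)

lemma psf_odd:
  "n \<ge> 1 \<Longrightarrow> psf (2 * n + 1) = psf (2 * n) + card (SF (2 * n)) + psf (2 * n - 1)"
  unfolding psf_def by (subst sum_SF_odd) (simp_all add: sum.distrib bump_odd_part_def sum_Suc)

text \<open>Of the three consecutive numbers \<open>2 * n - 1\<close>, \<open>2 * n\<close>, \<open>2 * n + 1\<close> exactly one is divisible
  by 3. Likewise, unless \<open>a\<close> and \<open>b\<close> are both even, exactly one of \<open>a\<close>, \<open>b\<close>, \<open>a + b\<close> is.\<close>

lemma even_card_SF_iff: "m \<ge> 1 \<Longrightarrow> even (card (SF m)) \<longleftrightarrow> 3 dvd m"
proof (induction m rule: SF_induct)
  case one
  show ?case by (simp add: SF_1 [simplified])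
next
  case (double n)
  then have "even (card (SF (2 * n))) \<longleftrightarrow> 3 dvd n"
    by (simp add: card_SF_double)
  also have "\<dots> \<longleftrightarrow> 3 dvd 2 * n"
    by presburger
  finally show ?case .
next
  case (odd n)
  have "even (card (SF (2 * n + 1))) \<longleftrightarrow> (3 dvd 2 * n \<longleftrightarrow> 3 dvd 2 * n - 1)"
    using odd by (simp only: card_SF_odd even_add)
  also have "\<dots> \<longleftrightarrow> 3 dvd 2 * n + 1"
    using odd.hyps by presburger
  finally show ?case .
qed

text \<open>Naming the three indices separately lets arithmetic match them with any way of writing a
  linear expression in \<open>n\<close>.\<close>

lemma even_psf_odd:
  assumes "l + 1 = 2 * k" "m = 2 * k + 1"
  shows "even (psf m) \<longleftrightarrow> (even (psf k) \<longleftrightarrow> (3 dvd k \<longleftrightarrow> even (psf l)))"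
proof -
  have k: "k \<ge> 1" and l: "l = 2 * k - 1"
    using assms by linarith+
  have "psf m = psf k + card (SF k) + psf l"
    using k by (simp only: l assms(2) psf_odd psf_double card_SF_double)
  then show ?thesis
    using even_card_SF_iff [OF k] by auto
qed

lemma even_psf_8n_plus_3:
  "even (psf (8 * n + 3)) \<longleftrightarrow> (even (psf (4 * n + 1)) \<longleftrightarrow> (3 dvd n + 1 \<longleftrightarrow> even (psf (8 * n + 1))))"
proof -
  have "even (psf (8 * n + 3)) \<longleftrightarrow>
      (even (psf (4 * n + 1)) \<longleftrightarrow> (3 dvd 4 * n + 1 \<longleftrightarrow> even (psf (8 * n + 1))))"
    by (rule even_psf_odd) simp_all
  moreover have "3 dvd 4 * n + 1 \<longleftrightarrow> 3 dvd n + 1"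
    by presburger
  ultimately show ?thesis
    by simp
qed

lemma even_psf_8n_plus_5:
  "even (psf (8 * n + 5)) \<longleftrightarrow> (even (psf (2 * n + 1)) \<longleftrightarrow> (3 dvd n + 2 \<longleftrightarrow> even (psf (8 * n + 3))))"
proof -
  have "even (psf (8 * n + 5)) \<longleftrightarrow>
      (even (psf (4 * n + 2)) \<longleftrightarrow> (3 dvd 4 * n + 2 \<longleftrightarrow> even (psf (8 * n + 3))))"
    by (rule even_psf_odd) simp_all
  moreover have "3 dvd 4 * n + 2 \<longleftrightarrow> 3 dvd n + 2"
    by presburger
  moreover have "psf (4 * n + 2) = psf (2 * n + 1)"
    using psf_double [of "2 * n + 1"] by simp
  ultimately show ?thesis
    by simp
qed

text \<open>From \<open>n\<close> to \<open>n + 1\<close> the first argument grows by 8, which takes four steps of the recursion.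
  They contribute \<open>psf\<close> at \<open>4 * n + 1\<close>, \<open>2 * n + 1\<close>, \<open>4 * n + 3\<close> and \<open>n + 1\<close>. One more step
  relates \<open>psf (4 * n + 3)\<close> to \<open>psf (4 * n + 1)\<close> and \<open>psf (2 * n + 1)\<close>, so that modulo 2 the first
  three add up to a cardinality. What is left, \<open>psf (n + 1)\<close>, is also the contribution of the
  single step from \<open>2 * n + 1\<close> to \<open>2 * n + 3\<close>.\<close>

lemma even_psf_add_iff: "even (psf (8 * n + 1) + psf (2 * n + 1)) \<longleftrightarrow> 3 dvd n"
proof (induction n)
  case 0
  show ?case by simp
next
  case (Suc n)
  have step7: "even (psf (8 * n + 7)) \<longleftrightarrow>
      (even (psf (4 * n + 3)) \<longleftrightarrow> (3 dvd 4 * n + 3 \<longleftrightarrow> even (psf (8 * n + 5))))"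
    by (rule even_psf_odd) simp_all
  have step9: "even (psf (8 * n + 9)) \<longleftrightarrow>
      (even (psf (4 * n + 4)) \<longleftrightarrow> (3 dvd 4 * n + 4 \<longleftrightarrow> even (psf (8 * n + 7))))"
    by (rule even_psf_odd) simp_all
  have step4: "even (psf (4 * n + 3)) \<longleftrightarrow>
      (even (psf (2 * n + 1)) \<longleftrightarrow> (3 dvd 2 * n + 1 \<longleftrightarrow> even (psf (4 * n + 1))))"
    by (rule even_psf_odd) simp_all
  have step2: "even (psf (2 * n + 3)) \<longleftrightarrow>
      (even (psf (n + 1)) \<longleftrightarrow> (3 dvd n + 1 \<longleftrightarrow> even (psf (2 * n + 1))))"
    by (rule even_psf_odd) simp_all
  have quadruple: "psf (4 * n + 4) = psf (n + 1)"
  proof -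
    have "4 * n + 4 = 2 * (2 * (n + 1))"
      by simp
    then show ?thesis
      by (simp only: psf_double)
  qed
  have mod3: "3 dvd 4 * n + 3 \<longleftrightarrow> 3 dvd n" "3 dvd 4 * n + 4 \<longleftrightarrow> 3 dvd n + 1"
    "3 dvd 2 * n + 1 \<longleftrightarrow> 3 dvd n + 2"
    by presburger+
  \<comment> \<open>As equivalence is addition modulo 2, unfolding all the steps leaves a propositional tautology.\<close>
  have "even (psf (8 * n + 9) + psf (2 * n + 3)) \<longleftrightarrow> 3 dvd n + 1"
    using Suc.IH
    by (simp only: even_add step9 step7 step4 step2 quadruple mod3
        even_psf_8n_plus_5 even_psf_8n_plus_3) satx
  moreover have "8 * Suc n + 1 = 8 * n + 9" "2 * Suc n + 1 = 2 * n + 3" "Suc n = n + 1"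
    by simp_all
  ultimately show ?case
    by (simp only:)
qed

theorem theorem9p3:
  fixes n :: nat
  shows "[psf (8 * n + 2) = psf (8 * n + 5)] (mod 2)"
proof -
  have double: "psf (8 * n + 2) = psf (4 * n + 1)"
    using psf_double [of "4 * n + 1"] by simp
  \<comment> \<open>The right-hand side is the parity of the sum of the two cardinalities met on the way from
    \<open>8 * n + 1\<close> to \<open>8 * n + 5\<close>.\<close>
  have "3 dvd n \<longleftrightarrow> (3 dvd n + 1 \<longleftrightarrow> 3 dvd n + 2)"
    by presburger
  then have "even (psf (8 * n + 2)) \<longleftrightarrow> even (psf (8 * n + 5))"
    using even_psf_add_iff [of n]
    by (simp only: double even_add even_psf_8n_plus_5 even_psf_8n_plus_3) satx
  then show ?thesis
    unfolding cong_def by presburger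
qed

end
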